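(* Let $g : X \to [1,+\infty)$ be a scientific citation index satisfying Monotonicity, Symmetry, Strong Scale Invariance, and Max-Bounded. (i) If $g$ additionally satisfies Weak Responsiveness, then $g = h_a$ for some real $a > 0$. (ii) If $g$ additionally satisfies both Weak Responsiveness and Linear Growth, then $g = h' = h_{1/2}$. (iii) If $g$ additionally satisfies Square Root Responsiveness (with no assumption of Linear Growth), then $g = h' = h_{1/2}$.
   Context: $\mathbb{N}$ is the set of positive integers. A citation record is a finite vector $\mathbf{x} = (x_1,\dots,x_{l(\mathbf{x})})$ of positive integers with $x_1 \ge x_2 \ge \dots \ge x_{l(\mathbf{x})}$ and length $l(\mathbf{x}) \ge 1$; $X$ is the set of all citation records. A scientific citation index is a function $g : X \to [1,+\infty)$ with $g(1)=1$; here and below $g(n)$ for $n\in\mathbb{N}$ means $g$ applied to the one-entry record $(n)$, and $g(2,2)$ means $g$ applied to the record $(2,2)$. For $a>0$, $h_a(\mathbf{x}) = \max_{1\le k\le l(\mathbf{x})} (k\cdot x_k)^a$ (scale invariant Hirsch powers), and the scale-invariant Hirsch index is $h' = h_{1/2}$, i.e. $h'(\mathbf{x}) = \max_{1\le k\le l(\mathbf{x})} (k x_k)^{1/2}$. Axioms for $g$: Monotonicity: if $l(\mathbf{x})\le l(\mathbf{y})$ and $x_k\le y_k$ for all $1\le k\le l(\mathbf{x})$, then $g(\mathbf{x})\le g(\mathbf{y})$. Symmetry: $g(\mathbf{x}) = g(\mathbf{x}^* )$ for all $\mathbf{x}\in X$, where $\mathbf{x}^*$ is the dual record, obtained by reflecting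 the bar graph of $\mathbf{x}$ (bars of width $1$ and heights $x_1,x_2,\dots$) about the line $y=x$; that is, $\mathbf{x}^*$ has length $x_1$ and $x^*_j = |\{i : x_i\ge j\}|$. Strong Scale Invariance: for all $\mathbf{x},\mathbf{y}\in X$ and all $k,m\in\mathbb{N}$, $g(\mathbf{x})\cdot g(k\,\mathbf{y}^{\leftrightarrow m}) = g(\mathbf{y})\cdot g(k\,\mathbf{x}^{\leftrightarrow m})$, where $k\mathbf{x} = (kx_1,\dots,kx_{l(\mathbf{x})})$ and $\mathbf{x}^{\leftrightarrow m}$ is the record of length $m\,l(\mathbf{x})$ in which each entry of $\mathbf{x}$ is repeated $m$ times. Max-Bounded: for all $\mathbf{x},\mathbf{y}\in X$, $g(\mathbf{z})\le\max\{g(\mathbf{x}),g(\mathbf{y})\}$, where $\mathbf{z}$ is the componentwise maximum of $\mathbf{x}$ and $\mathbf{y}$: it has length $\max\{l(\mathbf{x}),l(\mathbf{y})\}$, with $z_i=\max\{x_i,y_i\}$ when both entries exist and $z_i$ equal to the one existing entry otherwise. Weak Responsiveness: $g(2,2) > g(1)$. Square Root Responsiveness: $g(2)=\sqrt{2}$. Linear Growth: for all positive integers $p,c$, the points $(n, g(\mathbf{x}(n)))$, $n\in\mathbb{N}$, all lie within a strip bounded by two parallel straight lines, where $\mathbf{x}(n)$ is the record after $n$ years of a researcher who publishes exactly $p$ papers each year, each paper attracting exactly $c$ citations in its year of publication and in each subsequent year; i.e. $\mathbf{x}(n)$ consists of $cn$ repeated $p$ times, then $c(n-1)$ repeated $p$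 times, ..., then $c$ repeated $p$ times. *)

theory Defs
  imports Complex_Main
begin

text \<open>Records are lists indexed from 0, so the entry written \<open>x\<^sub>k\<close> (with \<open>k \<ge> 1\<close>) is
  \<open>x ! (k - 1)\<close>. A citation index is a function on all lists of naturals of which only
  the values on \<open>citation_records\<close> matter.\<close>

definition citation_records :: "nat list set" where
  "citation_records = {x. x \<noteq> [] \<and> sorted_wrt (\<ge>) x \<and> (\<forall>n\<in>set x. n > 0)}"

definition citation_index :: "(nat list \<Rightarrow> real) \<Rightarrow> bool" where
  "citation_index g \<longleftrightarrow> (\<forall>x\<in>citation_records. g x \<ge> 1) \<and> g [1] = 1"

definition hirsch_power :: "real \<Rightarrow> nat list \<Rightarrow> real" where
  "hirsch_power a x = Max ((\<lambda>k. real (k * x ! (k - 1)) powr a) ` {1..length x})"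

definition scale_invariant_hirsch :: "nat list \<Rightarrow> real" where
  "scale_invariant_hirsch = hirsch_power (1 / 2)"

definition monotonicity :: "(nat list \<Rightarrow> real) \<Rightarrow> bool" where
  "monotonicity g \<longleftrightarrow>
     (\<forall>x\<in>citation_records. \<forall>y\<in>citation_records.
        length x \<le> length y \<and> (\<forall>i<length x. x ! i \<le> y ! i) \<longrightarrow> g x \<le> g y)"

text \<open>The largest entry of a record is its first one, and it is the length of the dual record.\<close>

definition dual_record :: "nat list \<Rightarrow> nat list" where
  "dual_record x = map (\<lambda>j. card {i. i < length x \<and> x ! i \<ge> j}) [1..<Suc (x ! 0)]"

definition symmetry :: "(nat list \<Rightarrow> real) \<Rightarrow> bool" where
  "symmetry g \<longleftrightarrow> (\<forall>x\<in>citation_records. g x = g (dual_record x))"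

definition scale_record :: "nat \<Rightarrow> nat list \<Rightarrow> nat list" where
  "scale_record k x = map (\<lambda>n. k * n) x"

definition repeat_entries :: "nat \<Rightarrow> nat list \<Rightarrow> nat list" where
  "repeat_entries m x = concat (map (replicate m) x)"

definition strong_scale_invariance :: "(nat list \<Rightarrow> real) \<Rightarrow> bool" where
  "strong_scale_invariance g \<longleftrightarrow>
     (\<forall>x\<in>citation_records. \<forall>y\<in>citation_records. \<forall>k\<ge>1. \<forall>m\<ge>1.
        g x * g (scale_record k (repeat_entries m y)) =
        g y * g (scale_record k (repeat_entries m x)))"

definition max_record :: "nat list \<Rightarrow> nat list \<Rightarrow> nat list" where
  "max_record x y =
     map (\<lambda>i. if i < length x \<and> i < length y then max (x ! i) (y ! i)
              else if i < length x then x ! i else y ! i)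
       [0..<max (length x) (length y)]"

definition max_bounded :: "(nat list \<Rightarrow> real) \<Rightarrow> bool" where
  "max_bounded g \<longleftrightarrow>
     (\<forall>x\<in>citation_records. \<forall>y\<in>citation_records. g (max_record x y) \<le> max (g x) (g y))"

definition weak_responsiveness :: "(nat list \<Rightarrow> real) \<Rightarrow> bool" where
  "weak_responsiveness g \<longleftrightarrow> g [2, 2] > g [1]"

definition square_root_responsiveness :: "(nat list \<Rightarrow> real) \<Rightarrow> bool" where
  "square_root_responsiveness g \<longleftrightarrow> g [2] = sqrt 2"

text \<open>The record \<open>x(n)\<close> of a researcher with \<open>p\<close> papers per year and \<open>c\<close> citations per
  paper and year: the entries are \<open>c * n\<close>, \<open>c * (n - 1)\<close>, ..., \<open>c\<close>, each occurring \<open>p\<close> times.\<close>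

definition steady_record :: "nat \<Rightarrow> nat \<Rightarrow> nat \<Rightarrow> nat list" where
  "steady_record p c n = concat (map (\<lambda>j. replicate p (c * j)) (rev [1..<Suc n]))"

text \<open>For \<open>(\<alpha>, \<beta>) \<noteq> (0, 0)\<close> and \<open>d < e\<close>, the closed region of the plane between the
  parallel lines \<open>\<alpha> u + \<beta> v = d\<close> and \<open>\<alpha> u + \<beta> v = e\<close>.\<close>

definition strip :: "real \<Rightarrow> real \<Rightarrow> real \<Rightarrow> real \<Rightarrow> (real \<times> real) set" where
  "strip \<alpha> \<beta> d e = {(u, v). d \<le> \<alpha> * u + \<beta> * v \<and> \<alpha> * u + \<beta> * v \<le> e}"

definition linear_growth :: "(nat list \<Rightarrow> real) \<Rightarrow> bool" where
  "linear_growth g \<longleftrightarrow>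
     (\<forall>p\<ge>1. \<forall>c\<ge>1. \<exists>\<alpha> \<beta> d e. (\<alpha>, \<beta>) \<noteq> (0, 0) \<and> d < e \<and>
        (\<forall>n\<ge>1. (real n, g (steady_record p c n)) \<in> strip \<alpha> \<beta> d e))"

end

theory Submission
  imports Defs "HOL-Real_Asymp.Real_Asymp"
begin

text \<open>
  Under Strong Scale Invariance and Symmetry the whole index is governed by the one-entry
  records. Put \<open>f n = g [n]\<close>. Comparing with the unit record \<open>[1]\<close> shows that \<open>f\<close> is completely
  multiplicative and that a rectangle, \<open>m\<close> papers with \<open>k\<close> citations each, has the value
  \<open>f k\<close> times the value of the column of \<open>m\<close> papers with one citation, which by Symmetry is
  \<open>f m\<close>. So a rectangle has the value \<open>f (k * m)\<close> (\<open>index_rectangle\<close>).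

  By Monotonicity \<open>f\<close> is nondecreasing, and a nondecreasing completely multiplicative function
  is a power \<open>n powr a\<close> (\<open>mono_multiplicative_is_powr\<close>): squeeze \<open>n ^ k\<close> between consecutive
  powers of 2 and let \<open>k\<close> grow.

  A record is the componentwise maximum of the rectangles inscribed in its bar graph. Its index
  is at least that of each rectangle by Monotonicity, and at most their maximum by
  Max-Boundedness, so \<open>g = h\<^sub>a\<close> (\<open>index_eq_hirsch_power\<close>).

  The remaining axioms only fix the exponent. Weak Responsiveness says \<open>4 powr a > 1\<close>, that is,
  \<open>a > 0\<close>; Square Root Responsiveness says \<open>2 powr a = sqrt 2\<close>, that is, \<open>a = 1 / 2\<close>.
  For Linear Growth the staircase records \<open>n, n - 1, \<dots>, 1\<close> with \<open>n = 2 * m - 1\<close> suffice: their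
  largest inscribed rectangle is the \<open>m \<times> m\<close> square, so the index is \<open>m powr (2 * a)\<close>, and
  this stays at a bounded distance from a line in \<open>m\<close> only if \<open>2 * a = 1\<close>.
\<close>

section \<open>Monotone completely multiplicative functions\<close>

lemma zero_if_multiples_bounded:
  fixes t C :: real
  assumes "\<And>k::nat. \<bar>real k * t\<bar> \<le> C"
  shows "t = 0"
proof (rule ccontr)
  assume "t \<noteq> 0"
  then obtain k :: nat where "C < real k * \<bar>t\<bar>"
    using reals_Archimedean3[of "\<bar>t\<bar>"] by auto
  with assms[of k] show False by (simp add: abs_mult)
qed

text \<open>The logarithms \<open>ln (f n)\<close> and \<open>ln n\<close> are proportional. With \<open>j = \<lfloor>k * log 2 n\<rfloor>\<close>, the
  inequalities \<open>2 ^ j \<le> n ^ k \<le> 2 ^ (j + 1)\<close> are preserved by \<open>f\<close>, so the error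
  \<open>ln (f n) - log 2 n * ln (f 2)\<close> is at most \<open>ln (f 2) / k\<close> for every \<open>k\<close>.\<close>

lemma mono_multiplicative_is_powr:
  fixes f :: "nat \<Rightarrow> real"
  assumes ge1: "\<And>n. n \<ge> 1 \<Longrightarrow> f n \<ge> 1"
    and mult: "\<And>m n. m \<ge> 1 \<Longrightarrow> n \<ge> 1 \<Longrightarrow> f (m * n) = f m * f n"
    and mono: "\<And>m n. 1 \<le> m \<Longrightarrow> m \<le> n \<Longrightarrow> f m \<le> f n"
    and "n \<ge> 1"
  shows "f n = real n powr log 2 (f 2)"
proof -
  have "f 1 = 1"
    using mult[of 1 1] ge1[of 1] by simp
  have pow: "f (m ^ k) = f m ^ k" if "m \<ge> 1" for m k
    using that \<open>f 1 = 1\<close> by (induction k) (simp_all add: mult)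
  have pos: "f m > 0" if "m \<ge> 1" for m
    using ge1[OF that] by linarith
  define A where "A = ln (f 2)"
  define L where "L = log 2 (real n)"
  have "A \<ge> 0" using ge1[of 2] by (simp add: A_def)
  have "L \<ge> 0" using \<open>n \<ge> 1\<close> by (simp add: L_def)
  have "\<bar>real k * (ln (f n) - L * A)\<bar> \<le> A" for k
  proof -
    define j where "j = nat \<lfloor>real k * L\<rfloor>"
    have j: "real j \<le> real k * L" "real k * L \<le> real (Suc j)"
      using \<open>L \<ge> 0\<close> unfolding j_def by (auto simp: le_nat_iff) linarith
    have npow: "2 powr (real k * L) = real (n ^ k)"
      using \<open>n \<ge> 1\<close> by (simp add: L_def powr_realpow mult.commute[of "real k"] flip: powr_powr)
    have two: "2 powr real i = real (2 ^ i)" for i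
      by (simp add: powr_realpow)
    have "real (2 ^ j) \<le> real (n ^ k)" "real (n ^ k) \<le> real (2 ^ Suc j)"
      unfolding npow[symmetric] two[symmetric] using j by (intro powr_mono; simp)+
    then have "2 ^ j \<le> n ^ k" "n ^ k \<le> 2 ^ Suc j"
      by (simp_all only: of_nat_le_iff)
    then have "f 2 ^ j \<le> f n ^ k" "f n ^ k \<le> f 2 ^ Suc j"
      using mono[of "2 ^ j" "n ^ k"] mono[of "n ^ k" "2 ^ Suc j"] pow[of 2] pow[of n] \<open>n \<ge> 1\<close>
      by (simp_all del: power_Suc)
    then have "ln (f 2 ^ j) \<le> ln (f n ^ k)" "ln (f n ^ k) \<le> ln (f 2 ^ Suc j)"
      using pos[of 2] pos[OF \<open>n \<ge> 1\<close>] by (simp_all del: power_Suc)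
    then have f: "real j * A \<le> real k * ln (f n)" "real k * ln (f n) \<le> real (Suc j) * A"
      using pos[of 2] pos[OF \<open>n \<ge> 1\<close>] by (simp_all add: ln_realpow A_def del: power_Suc)
    have "real j * A \<le> real k * L * A" "real k * L * A \<le> real (Suc j) * A"
      using j \<open>A \<ge> 0\<close> by (auto intro: mult_right_mono)
    with f show ?thesis by (simp add: algebra_simps abs_le_iff)
  qed
  then have "ln (f n) = L * A"
    using zero_if_multiples_bounded by fastforce
  then have "ln (f n) = log 2 (f 2) * ln (real n)"
    by (simp add: L_def A_def log_def)
  moreover have "f n = exp (ln (f n))"
    using pos[OF \<open>n \<ge> 1\<close>] by simp
  ultimately show ?thesis
    using \<open>n \<ge> 1\<close> by (simp add: powr_def)
qed

section \<open>Rectangles\<close>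

lemma replicate_in_citation_records:
  "m \<ge> 1 \<Longrightarrow> k \<ge> 1 \<Longrightarrow> replicate m k \<in> citation_records"
  by (auto simp: citation_records_def sorted_wrt_iff_nth_less)

lemma take_in_citation_records:
  "x \<in> citation_records \<Longrightarrow> k \<ge> 1 \<Longrightarrow> take k x \<in> citation_records"
  by (auto simp: citation_records_def dest: in_set_takeD)

lemma citation_record_nth_mono:
  "x \<in> citation_records \<Longrightarrow> i \<le> j \<Longrightarrow> j < length x \<Longrightarrow> x ! j \<le> x ! i"
  by (cases "i = j") (auto simp: citation_records_def sorted_wrt_iff_nth_less)

lemma citation_record_nth_pos:
  "x \<in> citation_records \<Longrightarrow> i < length x \<Longrightarrow> x ! i \<ge> 1"
  by (auto simp: citation_records_def Suc_le_eq)

lemma dual_record_singleton: "dual_record [m] = replicate m 1"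
  unfolding dual_record_def
proof (rule nth_equalityI)
  fix j assume "j < length (map (\<lambda>j. card {i. i < length [m] \<and> [m] ! i \<ge> j})
    [1..<Suc ([m] ! 0)])"
  then have "j < m" by (simp del: upt_Suc)
  moreover from this have "{i. i < length [m] \<and> [m] ! i \<ge> Suc j} = {0}"
    by auto
  ultimately show "map (\<lambda>j. card {i. i < length [m] \<and> [m] ! i \<ge> j}) [1..<Suc ([m] ! 0)] ! j
      = replicate m 1 ! j"
    by (simp del: upt_Suc)
qed simp

lemma index_singleton_mult:
  assumes "citation_index g" "strong_scale_invariance g" "m \<ge> 1" "n \<ge> 1"
  shows "g [m * n] = g [m] * g [n]"
proof -
  have "g [n] * g (scale_record m (repeat_entries 1 [1]))
      = g [1] * g (scale_record m (repeat_entries 1 [n]))"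
    using assms replicate_in_citation_records[of 1 n] replicate_in_citation_records[of 1 1]
    unfolding strong_scale_invariance_def by auto
  with assms show ?thesis
    by (simp add: scale_record_def repeat_entries_def citation_index_def mult.commute)
qed

lemma index_rectangle:
  assumes "citation_index g" "symmetry g" "strong_scale_invariance g" "m \<ge> 1" "k \<ge> 1"
  shows "g (replicate m k) = g [m * k]"
proof -
  have "g [k] * g (scale_record 1 (repeat_entries m [1]))
      = g [1] * g (scale_record 1 (repeat_entries m [k]))"
    using assms replicate_in_citation_records[of 1 k] replicate_in_citation_records[of 1 1]
    unfolding strong_scale_invariance_def by auto
  then have "g (replicate m k) = g [k] * g (replicate m 1)"
    using assms by (simp add: scale_record_def repeat_entries_def citation_index_def)
  also have "g (replicate m 1) = g [m]"
    using assms replicate_in_citation_records[of 1 m] dual_record_singleton[of m]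
    unfolding symmetry_def by auto
  finally show ?thesis
    using index_singleton_mult[of g m k] assms by simp
qed

section \<open>Records as unions of inscribed rectangles\<close>

text \<open>As entries are nonincreasing, the rectangle of width \<open>k + 1\<close> and height \<open>x ! k\<close> lies
  inside the record and contributes nothing before position \<open>k\<close>. So the record is built up by
  adjoining these rectangles one after the other.\<close>

lemma max_record_take_rectangle:
  assumes "x \<in> citation_records" "k < length x"
  shows "max_record (take k x) (replicate (Suc k) (x ! k)) = take (Suc k) x"
proof (rule nth_equalityI)
  fix i assume "i < length (max_record (take k x) (replicate (Suc k) (x ! k)))"
  then have "i < Suc k" using assms(2) by (simp add: max_record_def del: upt_Suc replicate_Suc)
  then show "max_record (take k x) (replicate (Suc k) (x ! k)) ! i = take (Suc k) x ! i"
    using assms(2) citation_record_nth_mono[OF assms(1), of i k]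
    by (auto simp: max_record_def less_Suc_eq max_absorb1 simp del: upt_Suc replicate_Suc)
qed (use assms(2) in \<open>simp add: max_record_def del: upt_Suc replicate_Suc\<close>)

lemma index_le_of_rectangles:
  assumes "max_bounded g" "x \<in> citation_records"
    and bound: "\<And>k. k < length x \<Longrightarrow> g (replicate (Suc k) (x ! k)) \<le> B"
  shows "g x \<le> B"
proof -
  have "g (take (Suc k) x) \<le> B" if "k < length x" for k
    using that
  proof (induction k)
    case 0
    then show ?case using bound[of 0] by (simp add: take_Suc_conv_app_nth)
  next
    case (Suc k)
    have "replicate (Suc (Suc k)) (x ! Suc k) \<in> citation_records"
      using citation_record_nth_pos[OF assms(2) Suc.prems]
      by (intro replicate_in_citation_records) auto
    moreover have "take (Suc k) x \<in> citation_records"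
      using assms(2) by (rule take_in_citation_records) simp
    ultimately have "g (take (Suc (Suc k)) x)
        \<le> max (g (take (Suc k) x)) (g (replicate (Suc (Suc k)) (x ! Suc k)))"
      using assms(1) unfolding max_bounded_def
        max_record_take_rectangle[OF assms(2) Suc.prems, symmetric] by blast
    with Suc bound[OF Suc.prems] show ?case by linarith
  qed
  from this[of "length x - 1"] assms(2) show ?thesis
    by (cases x) (auto simp: citation_records_def)
qed

lemma index_rectangle_le:
  assumes "monotonicity g" "x \<in> citation_records" "k < length x"
  shows "g (replicate (Suc k) (x ! k)) \<le> g x"
proof -
  have "replicate (Suc k) (x ! k) \<in> citation_records"
    using citation_record_nth_pos[OF assms(2,3)] by (intro replicate_in_citation_records) auto
  moreover have "replicate (Suc k) (x ! k) ! i \<le> x ! i" if "i < Suc k" for i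
    using that assms citation_record_nth_mono[of x i k] by (simp del: replicate_Suc)
  ultimately show ?thesis
    using assms unfolding monotonicity_def by (auto simp del: replicate_Suc)
qed

lemma hirsch_power_eqI:
  assumes "\<And>k. k < length x \<Longrightarrow> real (Suc k * x ! k) powr a \<le> v"
    and "k < length x" "real (Suc k * x ! k) powr a = v"
  shows "hirsch_power a x = v"
  unfolding hirsch_power_def
proof (rule Max_eqI)
  fix y assume "y \<in> (\<lambda>k. real (k * x ! (k - 1)) powr a) ` {1..length x}"
  then obtain i where "1 \<le> i" "i \<le> length x" "y = real (i * x ! (i - 1)) powr a" by auto
  then show "y \<le> v" using assms(1)[of "i - 1"] by simp
next
  show "v \<in> (\<lambda>k. real (k * x ! (k - 1)) powr a) ` {1..length x}"
    using assms(2,3) by (intro image_eqI[of _ _ "Suc k"]) auto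
qed simp

lemma hirsch_power_ge:
  "k < length x \<Longrightarrow> real (Suc k * x ! k) powr a \<le> hirsch_power a x"
  unfolding hirsch_power_def by (intro Max_ge image_eqI[of _ _ "Suc k"]) auto

lemma hirsch_power_attained:
  assumes "x \<noteq> []"
  obtains k where "k < length x" "hirsch_power a x = real (Suc k * x ! k) powr a"
proof -
  have "hirsch_power a x \<in> (\<lambda>k. real (k * x ! (k - 1)) powr a) ` {1..length x}"
    unfolding hirsch_power_def using assms by (intro Max_in) (auto simp: Suc_le_eq)
  then obtain i where "1 \<le> i" "i \<le> length x"
    "hirsch_power a x = real (i * x ! (i - 1)) powr a" by auto
  then show ?thesis using that[of "i - 1"] by simp
qed

lemma index_eq_hirsch_power:
  assumes "citation_index g" "monotonicity g" "symmetry g" "strong_scale_invariance g"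
    "max_bounded g" and x: "x \<in> citation_records"
  shows "g x = hirsch_power (log 2 (g [2])) x"
proof -
  let ?a = "log 2 (g [2])"
  have single: "[n] \<in> citation_records" if "n \<ge> 1" for n
    using that replicate_in_citation_records[of 1 n] by simp
  have "g [n] \<ge> 1" if "n \<ge> 1" for n
    using assms(1) single[OF that] by (simp add: citation_index_def)
  moreover have "g [m] \<le> g [n]" if "1 \<le> m" "m \<le> n" for m n
  proof -
    have "length [m] \<le> length [n] \<and> (\<forall>i<length [m]. [m] ! i \<le> [n] ! i)"
      using that by simp
    with assms(2) single[of m] single[of n] that show ?thesis
      unfolding monotonicity_def by (meson order_trans)
  qed
  ultimately have power: "g [n] = real n powr ?a" if "n \<ge> 1" for n
    using that index_singleton_mult[OF assms(1,4)]
    by (intro mono_multiplicative_is_powr[where f = "\<lambda>n. g [n]"])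
  have rect: "g (replicate (Suc k) (x ! k)) = real (Suc k * x ! k) powr ?a"
    if "k < length x" for k
  proof -
    have "x ! k \<ge> 1" using x that by (rule citation_record_nth_pos)
    then have "g (replicate (Suc k) (x ! k)) = g [Suc k * x ! k]"
      by (intro index_rectangle assms) simp_all
    also have "\<dots> = real (Suc k * x ! k) powr ?a"
      using \<open>x ! k \<ge> 1\<close> by (intro power) simp
    finally show ?thesis .
  qed
  have "x \<noteq> []" using x by (simp add: citation_records_def)
  then obtain k where "k < length x" "hirsch_power ?a x = real (Suc k * x ! k) powr ?a"
    by (rule hirsch_power_attained)
  then have "hirsch_power ?a x \<le> g x"
    using index_rectangle_le[OF assms(2) x] rect by metis
  moreover have "g x \<le> hirsch_power ?a x"
    using assms(5) x by (rule index_le_of_rectangles) (metis rect hirsch_power_ge)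
  ultimately show ?thesis by simp
qed

section \<open>Linear growth determines the exponent\<close>

lemma steady_record_unit: "steady_record 1 1 n = rev [1..<Suc n]"
proof -
  have "concat (map (\<lambda>j. [j]) xs) = xs" for xs :: "nat list"
    by (induction xs) auto
  then show ?thesis by (simp add: steady_record_def)
qed

lemma staircase_in_citation_records:
  "n \<ge> 1 \<Longrightarrow> rev [1..<Suc n] \<in> citation_records"
  by (simp add: citation_records_def sorted_wrt_rev del: upt_Suc)

lemma hirsch_power_staircase:
  assumes "m \<ge> 1" "a \<ge> 0"
  shows "hirsch_power a (rev [1..<Suc (2 * m - 1)]) = real m powr (2 * a)"
proof (rule hirsch_power_eqI[where k = "m - 1"])
  let ?x = "rev [1..<Suc (2 * m - 1)]"
  have nth: "?x ! k = 2 * m - Suc k" if "k < 2 * m - 1" for k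
    using that by (simp add: rev_nth del: upt_Suc)
  have sq: "real (m * m) powr a = real m powr (2 * a)"
    using powr_add[of "real m" a a] assms by (simp add: powr_mult)
  show "m - 1 < length ?x" using assms by (simp del: upt_Suc)
  have "Suc (m - 1) * ?x ! (m - 1) = m * m"
    using assms nth[of "m - 1"] by (simp del: upt_Suc)
  then show "real (Suc (m - 1) * ?x ! (m - 1)) powr a = real m powr (2 * a)"
    using sq by simp
  show "real (Suc k * ?x ! k) powr a \<le> real m powr (2 * a)" if "k < length ?x" for k
  proof -
    have k: "k < 2 * m - 1" using that by (simp del: upt_Suc)
    \<comment> \<open>The rectangles in the maximum have semiperimeter \<open>2 * m\<close>, so their area is at
      most that of the \<open>m \<times> m\<close> square.\<close>
    have "0 \<le> (int m - int (Suc k))\<^sup>2" by simp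
    moreover have "int (2 * m - Suc k) = 2 * int m - int (Suc k)" using k by linarith
    ultimately have "int (Suc k * (2 * m - Suc k)) \<le> int (m * m)"
      unfolding of_nat_mult by (simp add: power2_eq_square algebra_simps)
    then have "Suc k * ?x ! k \<le> m * m"
      using nth[OF k] by (simp only: of_nat_le_iff)
    then have "real (Suc k * ?x ! k) powr a \<le> real (m * m) powr a"
      using assms by (intro powr_mono2) (simp_all only: of_nat_le_iff of_nat_0_le_iff)
    with sq show ?thesis by simp
  qed
qed

text \<open>The faster growing of the two terms \<open>m\<close> and \<open>m powr b\<close> must have coefficient zero, and
  then so must the other one, as both are unbounded.\<close>

lemma bounded_line_plus_powr:
  fixes \<alpha> \<beta> b d e :: real
  assumes "b > 0" "b \<noteq> 1"
    and bound: "\<And>m. m \<ge> 1 \<Longrightarrow> d \<le> \<alpha> * (2 * real m - 1) + \<beta> * real m powr b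
                        \<and> \<alpha> * (2 * real m - 1) + \<beta> * real m powr b \<le> e"
  shows "\<alpha> = 0 \<and> \<beta> = 0"
proof -
  define F where "F m = \<alpha> * (2 * real m - 1) + \<beta> * real m powr b" for m
  have scaled: "(\<lambda>m. F m / real m powr c) \<longlonglongrightarrow> 0" if "c > 0" for c
  proof (rule tendsto_sandwich)
    show "\<forall>\<^sub>F m in sequentially. d / real m powr c \<le> F m / real m powr c"
      and "\<forall>\<^sub>F m in sequentially. F m / real m powr c \<le> e / real m powr c"
      using bound unfolding F_def
      by (auto intro!: eventually_sequentiallyI[of 1] divide_right_mono)
    show "(\<lambda>m. d / real m powr c) \<longlonglongrightarrow> 0" "(\<lambda>m. e / real m powr c) \<longlonglongrightarrow> 0"
      using that by real_asymp+
  qed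
  show ?thesis
  proof (cases "b < 1")
    case True
    have "(\<lambda>m. F m / real m powr 1) \<longlonglongrightarrow> 2 * \<alpha>"
      unfolding F_def using True \<open>b > 0\<close> by real_asymp
    with scaled[of 1] have \<alpha>: "\<alpha> = 0" using LIMSEQ_unique by fastforce
    have "(\<lambda>m. F m / real m powr b) \<longlonglongrightarrow> \<beta>"
      unfolding F_def \<alpha> using \<open>b > 0\<close> by real_asymp
    with scaled[OF \<open>b > 0\<close>] \<alpha> show ?thesis using LIMSEQ_unique by blast
  next
    case False
    then have "b > 1" using assms by simp
    then have "(\<lambda>m. F m / real m powr b) \<longlonglongrightarrow> \<beta>"
      unfolding F_def by real_asymp
    with scaled[OF \<open>b > 0\<close>] have \<beta>: "\<beta> = 0" using LIMSEQ_unique by blast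
    have "(\<lambda>m. F m / real m powr 1) \<longlonglongrightarrow> 2 * \<alpha>"
      unfolding F_def \<beta> by real_asymp
    with scaled[of 1] \<beta> show ?thesis using LIMSEQ_unique by fastforce
  qed
qed

lemma linear_growth_exponent:
  assumes "linear_growth g" "a > 0"
    and g: "\<And>x. x \<in> citation_records \<Longrightarrow> g x = hirsch_power a x"
  shows "a = 1 / 2"
proof (rule ccontr)
  assume "a \<noteq> 1 / 2"
  \<comment> \<open>The strip may be vertical (\<open>\<beta> = 0\<close>); all that matters is that a nontrivial combination
    of \<open>2 * m - 1\<close> and \<open>m powr (2 * a)\<close> is bounded.\<close>
  obtain \<alpha> \<beta> d e where nz: "(\<alpha>, \<beta>) \<noteq> (0, 0)"
    and strip: "\<And>n. n \<ge> 1 \<Longrightarrow> (real n, g (steady_record 1 1 n)) \<in> strip \<alpha> \<beta> d e"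
    using assms(1) unfolding linear_growth_def by (metis order_refl)
  have "\<alpha> = 0 \<and> \<beta> = 0"
  proof (rule bounded_line_plus_powr[where b = "2 * a" and d = d and e = e])
    fix m :: nat assume "m \<ge> 1"
    then have "g (steady_record 1 1 (2 * m - 1)) = real m powr (2 * a)"
      using g[OF staircase_in_citation_records[of "2 * m - 1"]] hirsch_power_staircase[of m a]
        \<open>a > 0\<close> unfolding steady_record_unit by simp
    then show "d \<le> \<alpha> * (2 * real m - 1) + \<beta> * real m powr (2 * a)
        \<and> \<alpha> * (2 * real m - 1) + \<beta> * real m powr (2 * a) \<le> e"
      using strip[of "2 * m - 1"] \<open>m \<ge> 1\<close> by (simp add: strip_def)
  qed (use \<open>a > 0\<close> \<open>a \<noteq> 1 / 2\<close> in auto)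
  with nz show False by simp
qed

section \<open>Characterization of the scale-invariant Hirsch indices\<close>

theorem theorem6p3:
  fixes g :: "nat list \<Rightarrow> real"
  assumes "citation_index g"
    and "monotonicity g"
    and "symmetry g"
    and "strong_scale_invariance g"
    and "max_bounded g"
  shows "(weak_responsiveness g \<longrightarrow>
            (\<exists>a>0. \<forall>x\<in>citation_records. g x = hirsch_power a x))
       \<and> (weak_responsiveness g \<and> linear_growth g \<longrightarrow>
            (\<forall>x\<in>citation_records. g x = scale_invariant_hirsch x))
       \<and> (square_root_responsiveness g \<longrightarrow>
            (\<forall>x\<in>citation_records. g x = scale_invariant_hirsch x))"
proof -
  define a where "a = log 2 (g [2])"
  have g: "g x = hirsch_power a x" if "x \<in> citation_records" for x
    unfolding a_def using assms that by (rule index_eq_hirsch_power)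
  have pos: "a > 0" if "weak_responsiveness g"
  proof -
    have "g [2] \<ge> 1"
      using assms(1) by (simp add: citation_index_def citation_records_def)
    moreover have "g [2, 2] = g [2] * g [2]"
      using index_rectangle[OF assms(1,3,4), of 2 2] index_singleton_mult[OF assms(1,4), of 2 2]
      by (simp add: numeral_2_eq_2)
    then have "g [2] \<noteq> 1"
      using that assms(1) by (auto simp: weak_responsiveness_def citation_index_def)
    ultimately show ?thesis by (simp add: a_def)
  qed
  have "a = 1 / 2" if "square_root_responsiveness g"
    using that by (simp add: a_def square_root_responsiveness_def log_def ln_sqrt)
  then show ?thesis
    using g pos linear_growth_exponent[of g a] unfolding scale_invariant_hirsch_def by metis
qed

end
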